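(* Let $(\bm B^n,\bm v^n)$ and $(\bm B^{n+1},\bm v^{n+1})$ be related by the three-dimensional finite difference CT scheme given in the context. Assume $\bm B^n_{ijk}$ satisfies the discrete divergence-free condition $(\nabla\cdot\bm B)^n_{ijk}=0$ for all $i,j,k$. Then $\bm B^{n+1}_{ijk}$ also satisfies the discrete divergence-free condition: $(\nabla\cdot\bm B)^{n+1}_{ijk}=0$ for all $i,j,k$.
   Context: Uniform 3D grid with spacings $\Delta x,\Delta y,\Delta z>0$, time step $\Delta t>0$; relations hold at all grid indices $(i,j,k)$ (infinite grid or periodic indexing). $\bm B_{ijk}=(B^x,B^y,B^z)^\top_{ijk}$, $\bm v_{ijk}=(v^x,v^y,v^z)^\top_{ijk}\in\mathbb R^3$, $\rho^n_{ijk}>0$ given. Set $\bm B^{n+\frac12}_{ijk}=\frac12(\bm B^n_{ijk}+\bm B^{n+1}_{ijk})$, $\bm v^{n+\frac12}_{ijk}=\frac12(\bm v^n_{ijk}+\bm v^{n+1}_{ijk})$, $\mathbf\Omega^{n+\frac12}_{ijk}=\bm B^{n+\frac12}_{ijk}\times\bm v^{n+\frac12}_{ijk}=(\Omega^x,\Omega^y,\Omega^z)^{n+\frac12}_{ijk}$. For a grid function $f$: $D_xf_{ijk}=\frac{f_{i+1,j,k}-f_{i-1,j,k}}{2\Delta x}$, $D_yf_{ijk}=\frac{f_{i,j+1,k}-f_{i,j-1,k}}{2\Delta y}$, $D_zf_{ijk}=\frac{f_{i,j,k+1}-f_{i,j,k-1}}{2\Delta z}$. The (implicit) CT scheme is,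 at every $(i,j,k)$, $$B^{x,n+1}=B^{x,n}-\Delta t\,D_y\Omega^{z,n+\frac12}+\Delta t\,D_z\Omega^{y,n+\frac12},\quad B^{y,n+1}=B^{y,n}+\Delta t\,D_x\Omega^{z,n+\frac12}-\Delta t\,D_z\Omega^{x,n+\frac12},$$ $$B^{z,n+1}=B^{z,n}-\Delta t\,D_x\Omega^{y,n+\frac12}+\Delta t\,D_y\Omega^{x,n+\frac12},\quad \rho^n\bm v^{n+1}=\rho^n\bm v^n-\Delta t\,\bm B^{n+\frac12}\times\operatorname{curl}\bm B^{n+\frac12},$$ with $\operatorname{curl}\bm B=(D_yB^z-D_zB^y,\ D_zB^x-D_xB^z,\ D_xB^y-D_yB^x)^\top$. The discrete divergence is $(\nabla\cdot\bm B)^n_{ijk}=D_xB^{x,n}_{ijk}+D_yB^{y,n}_{ijk}+D_zB^{z,n}_{ijk}$. *)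

theory Defs
  imports "HOL-Analysis.Analysis"
begin

text \<open>Grid functions live on the infinite grid, with integer indices. Periodic indexing is the
  special case of grid functions that are periodic in the indices.\<close>

type_synonym 'a grid = "int \<Rightarrow> int \<Rightarrow> int \<Rightarrow> 'a"

definition Dx :: "real \<Rightarrow> real grid \<Rightarrow> real grid" where
  "Dx dx f i j k = (f (i + 1) j k - f (i - 1) j k) / (2 * dx)"

definition Dy :: "real \<Rightarrow> real grid \<Rightarrow> real grid" where
  "Dy dy f i j k = (f i (j + 1) k - f i (j - 1) k) / (2 * dy)"

definition Dz :: "real \<Rightarrow> real grid \<Rightarrow> real grid" where
  "Dz dz f i j k = (f i j (k + 1) - f i j (k - 1)) / (2 * dz)"

definition grid_comp :: "3 \<Rightarrow> (real ^ 3) grid \<Rightarrow> real grid" where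
  "grid_comp a F i j k = F i j k $ a"

definition discrete_div :: "real \<Rightarrow> real \<Rightarrow> real \<Rightarrow> (real ^ 3) grid \<Rightarrow> real grid" where
  "discrete_div dx dy dz B i j k =
     Dx dx (grid_comp 1 B) i j k + Dy dy (grid_comp 2 B) i j k + Dz dz (grid_comp 3 B) i j k"

definition discrete_curl :: "real \<Rightarrow> real \<Rightarrow> real \<Rightarrow> (real ^ 3) grid \<Rightarrow> (real ^ 3) grid" where
  "discrete_curl dx dy dz B i j k = vector
     [Dy dy (grid_comp 3 B) i j k - Dz dz (grid_comp 2 B) i j k,
      Dz dz (grid_comp 1 B) i j k - Dx dx (grid_comp 3 B) i j k,
      Dx dx (grid_comp 2 B) i j k - Dy dy (grid_comp 1 B) i j k]"

definition midpoint_grid :: "(real ^ 3) grid \<Rightarrow> (real ^ 3) grid \<Rightarrow> (real ^ 3) grid" where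
  "midpoint_grid F0 F1 i j k = (1 / 2) *\<^sub>R (F0 i j k + F1 i j k)"

definition Omega_half ::
  "(real ^ 3) grid \<Rightarrow> (real ^ 3) grid \<Rightarrow> (real ^ 3) grid \<Rightarrow> (real ^ 3) grid \<Rightarrow> (real ^ 3) grid" where
  "Omega_half B0 v0 B1 v1 i j k = cross3 (midpoint_grid B0 B1 i j k) (midpoint_grid v0 v1 i j k)"

text \<open>The implicit scheme as a relation between the states \<open>(B0, v0)\<close> at time level \<open>n\<close> and
  \<open>(B1, v1)\<close> at time level \<open>n + 1\<close>; \<open>rho\<close> is the density at level \<open>n\<close>.\<close>

definition CT_scheme ::
  "real \<Rightarrow> real \<Rightarrow> real \<Rightarrow> real \<Rightarrow> real grid \<Rightarrow>
   (real ^ 3) grid \<Rightarrow> (real ^ 3) grid \<Rightarrow> (real ^ 3) grid \<Rightarrow> (real ^ 3) grid \<Rightarrow> bool" where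
  "CT_scheme dx dy dz dt rho B0 v0 B1 v1 \<longleftrightarrow>
    (let Om = Omega_half B0 v0 B1 v1; Bh = midpoint_grid B0 B1 in
     \<forall>i j k.
       grid_comp 1 B1 i j k =
         grid_comp 1 B0 i j k - dt * Dy dy (grid_comp 3 Om) i j k + dt * Dz dz (grid_comp 2 Om) i j k \<and>
       grid_comp 2 B1 i j k =
         grid_comp 2 B0 i j k + dt * Dx dx (grid_comp 3 Om) i j k - dt * Dz dz (grid_comp 1 Om) i j k \<and>
       grid_comp 3 B1 i j k =
         grid_comp 3 B0 i j k - dt * Dx dx (grid_comp 2 Om) i j k + dt * Dy dy (grid_comp 1 Om) i j k \<and>
       rho i j k *\<^sub>R v1 i j k =
         rho i j k *\<^sub>R v0 i j k -
         dt *\<^sub>R cross3 (Bh i j k) (discrete_curl dx dy dz Bh i j k))"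

end

(* The scheme reads B^{n+1} = B^n - dt curl Omega with the discrete curl, and the discrete
   divergence of a discrete curl vanishes because centred differences in different directions
   commute. *)
theory Submission
  imports Defs
begin

text \<open>By linearity (\<open>discrete_div_diff_scaleR\<close>) the update
  \<open>CT_scheme_induction_eq\<close> changes the divergence by -\<open>dt\<close> times that of a
  curl, which is 0 for any field, even an \<open>Omega_half\<close> depending on
  \<open>B1\<close>.\<close>

lemma discrete_div_curl:
  "discrete_div dx dy dz (discrete_curl dx dy dz F) i j k = 0"
  \<comment> \<open>\<open>mult.commute\<close> aligns the denominators of the two orders of
    differencing.\<close>
  by (simp add: discrete_div_def discrete_curl_def grid_comp_def Dx_def Dy_def Dz_def
      diff_divide_distrib mult.commute)

lemma discrete_div_diff_scaleR:
  "discrete_div dx dy dz (\<lambda>i j k. F i j k - c *\<^sub>R G i j k) i j k =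
   discrete_div dx dy dz F i j k - c * discrete_div dx dy dz G i j k"
  by (simp add: discrete_div_def grid_comp_def Dx_def Dy_def Dz_def
      diff_divide_distrib add_divide_distrib algebra_simps)

text \<open>An equality of whole grid functions, since the divergence reads \<open>B1\<close> at
  neighbouring indices.\<close>

lemma CT_scheme_induction_eq:
  assumes "CT_scheme dx dy dz dt rho B0 v0 B1 v1"
  shows "B1 = (\<lambda>i j k. B0 i j k - dt *\<^sub>R discrete_curl dx dy dz (Omega_half B0 v0 B1 v1) i j k)"
  using assms
  by (simp add: CT_scheme_def Let_def fun_eq_iff vec_eq_iff forall_3 discrete_curl_def
      grid_comp_def algebra_simps)

theorem theorem4p2:
  fixes dx dy dz dt :: real
    and rho :: "real grid"
    and B0 v0 B1 v1 :: "(real ^ 3) grid"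
  assumes "dx > 0" and "dy > 0" and "dz > 0" and "dt > 0"
    and "\<And>i j k. rho i j k > 0"
    and "CT_scheme dx dy dz dt rho B0 v0 B1 v1"
    and "\<And>i j k. discrete_div dx dy dz B0 i j k = 0"
  shows "\<forall>i j k. discrete_div dx dy dz B1 i j k = 0"
  \<comment> \<open>A single rewrite: the scheme is implicit, so \<open>B1\<close> recurs on the
    right.\<close>
  by (subst CT_scheme_induction_eq[OF assms(6)])
    (simp add: discrete_div_diff_scaleR discrete_div_curl assms(7))

end
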